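(* Let $T$ be a tree. Then some cycle arising as a product of the edge-transpositions of $T$ (over an ordering of all edges) has multiplicity $1$ if and only if $T$ is a caterpillar.
   Context: Each edge $\{i,j\}$ is regarded as the transposition $(i,j)$; an ordering lists every edge exactly once. The multiplicity of a cycle $c$ is the number of orderings whose product is $c$. A caterpillar is a tree with the property that removing all its leaves (vertices of degree 1, with their edges) gives a path. *)

theory Defs
  imports "HOL-Combinatorics.Cycles" "HOL-Combinatorics.Multiset_Permutations"
begin

text \<open>A finite simple graph is given by its vertex set \<open>V\<close> and its set \<open>E\<close> of edges, the latter
  being two-element subsets of \<open>V\<close>.\<close>

definition simple_graph :: "'a set \<Rightarrow> 'a set set \<Rightarrow> bool" where
  "simple_graph V E \<longleftrightarrow> finite V \<and> (\<forall>e\<in>E. e \<subseteq> V \<and> card e = 2)"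

definition graph_connected :: "'a set \<Rightarrow> 'a set set \<Rightarrow> bool" where
  "graph_connected V E \<longleftrightarrow> V \<noteq> {} \<and> (\<forall>u\<in>V. \<forall>v\<in>V. (u, v) \<in> {(x, y). {x, y} \<in> E}\<^sup>*)"

definition path_edges :: "'a list \<Rightarrow> 'a set set" where
  "path_edges xs = {{xs ! i, xs ! Suc i} | i. Suc i < length xs}"

definition graph_acyclic :: "'a set set \<Rightarrow> bool" where
  "graph_acyclic E \<longleftrightarrow>
     \<not> (\<exists>xs. distinct xs \<and> 3 \<le> length xs \<and> path_edges xs \<subseteq> E \<and> {last xs, hd xs} \<in> E)"

definition is_tree :: "'a set \<Rightarrow> 'a set set \<Rightarrow> bool" where
  "is_tree V E \<longleftrightarrow> simple_graph V E \<and> graph_connected V E \<and> graph_acyclic E"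

text \<open>The empty graph counts as a path: it is what remains of the tree with a single edge once
  its two leaves are removed.\<close>

definition is_path_graph :: "'a set \<Rightarrow> 'a set set \<Rightarrow> bool" where
  "is_path_graph V E \<longleftrightarrow> (\<exists>xs. distinct xs \<and> set xs = V \<and> path_edges xs = E)"

definition vertex_degree :: "'a set set \<Rightarrow> 'a \<Rightarrow> nat" where
  "vertex_degree E v = card {e \<in> E. v \<in> e}"

definition leaves :: "'a set \<Rightarrow> 'a set set \<Rightarrow> 'a set" where
  "leaves V E = {v \<in> V. vertex_degree E v = 1}"

definition is_caterpillar :: "'a set \<Rightarrow> 'a set set \<Rightarrow> bool" where
  "is_caterpillar V E \<longleftrightarrow>
     is_tree V E \<and> is_path_graph (V - leaves V E) {e \<in> E. e \<inter> leaves V E = {}}"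

definition edge_transposition :: "'a set \<Rightarrow> 'a \<Rightarrow> 'a" where
  "edge_transposition e = (THE t. \<exists>i j. e = {i, j} \<and> t = Transposition.transpose i j)"

lemma edge_transposition_pair: "edge_transposition {i, j} = Transposition.transpose i j"
  unfolding edge_transposition_def
  by (rule the_equality) (auto simp: doubleton_eq_iff transpose_commute)

text \<open>Factors act from right to left. Reversing an ordering inverts its product, so the opposite
  convention gives the same multiplicities up to replacing each product by its inverse.\<close>

definition edge_product :: "'a set list \<Rightarrow> 'a \<Rightarrow> 'a" where
  "edge_product es = foldr (\<lambda>e p. edge_transposition e \<circ> p) es id"

definition cycle_multiplicity :: "'a set set \<Rightarrow> ('a \<Rightarrow> 'a) \<Rightarrow> nat" where
  "cycle_multiplicity E c = card {es \<in> permutations_of_set E. edge_product es = c}"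

text \<open>The identity is included as the cycle of length one, which is the product for the tree
  with a single vertex.\<close>

definition is_cycle :: "('a \<Rightarrow> 'a) \<Rightarrow> bool" where
  "is_cycle c \<longleftrightarrow> (\<exists>cs. cycle cs \<and> c = cycle_of_list cs)"

end

theory Submission
  imports Defs
begin

text \<open>An ordering in which two consecutive edges are disjoint has the same product as the ordering
  with these edges swapped, so multiplicity 1 forces consecutive edges to meet. Conversely, if
  consecutive edges meet, then the first edge is a leaf edge \<open>{u, v}\<close> with \<open>u\<close> the leaf, and any
  ordering with the same product also sends \<open>u\<close> to \<open>v\<close>. Since in a forest every vertex that is
  covered by a list of distinct edges is moved by their product, no edge at \<open>v\<close> precedes \<open>{u, v}\<close>
  there, so \<open>{u, v}\<close> may be cancelled from both orderings, and induction shows that they agree.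
  Finally, an ordering whose consecutive edges meet exists precisely for caterpillars: it runs along
  the spine and lists the edges at each spine vertex in turn.\<close>

abbreviation adj :: "'a set set \<Rightarrow> ('a \<times> 'a) set" where
  "adj E \<equiv> {(x, y). {x, y} \<in> E}"

abbreviation edge_chain :: "'a set list \<Rightarrow> bool" where
  "edge_chain \<equiv> successively (\<lambda>e f. e \<inter> f \<noteq> {})"

text \<open>Degree at least 2, stated without cardinalities or a vertex set, so that it applies
  directly to the edges of a sublist in an induction.\<close>

definition inner_vertices :: "'a set set \<Rightarrow> 'a set" where
  "inner_vertices E = {x. \<exists>e\<in>E. \<exists>f\<in>E. e \<noteq> f \<and> x \<in> e \<and> x \<in> f}"

section \<open>Simple paths, reachability and bridges in forests\<close>

lemma path_edges_Nil [simp]: "path_edges [] = {}"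
  and path_edges_single [simp]: "path_edges [x] = {}"
  by (auto simp: path_edges_def)

lemma path_edges_Cons_Cons [simp]:
  "path_edges (x # y # xs) = insert {x, y} (path_edges (y # xs))"
proof -
  \<comment> \<open>Index 0 yields the edge \<open>{x, y}\<close>, the shifted indices yield the
    path edges of the tail.\<close>
  have "{i. Suc i < length (x # y # xs)} = insert 0 (Suc ` {i. Suc i < length (y # xs)})"
    by (auto simp: image_iff gr0_conv_Suc less_Suc_eq_0_disj)
  moreover have "path_edges zs = (\<lambda>i. {zs ! i, zs ! Suc i}) ` {i. Suc i < length zs}" for zs :: "'a list"
    by (auto simp: path_edges_def)
  ultimately show ?thesis by (simp add: image_image)
qed

lemma path_edges_subset_Cons: "path_edges xs \<subseteq> path_edges (x # xs)"
  by (cases xs) auto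

lemma path_edges_suffix: "path_edges zs \<subseteq> path_edges (ys @ zs)"
  by (induction ys) (use path_edges_subset_Cons in fastforce)+

lemma path_edges_in_set: "e \<in> path_edges xs \<Longrightarrow> e \<subseteq> set xs"
  by (auto simp: path_edges_def)

text \<open>A simple path is built backwards along the walk; if the new vertex already occurs on the
  path, the detour before it is cut off.\<close>

lemma rtrancl_adj_imp_path:
  assumes "(u, v) \<in> (adj F)\<^sup>*"
  shows "\<exists>xs. distinct xs \<and> xs \<noteq> [] \<and> hd xs = u \<and> last xs = v \<and> path_edges xs \<subseteq> F"
  using assms
proof (induction rule: converse_rtrancl_induct)
  case base
  show ?case by (rule exI[of _ "[v]"]) simp
next
  case (step u w)
  then obtain xs where xs: "distinct xs" "xs \<noteq> []" "hd xs = w" "last xs = v" "path_edges xs \<subseteq> F"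
    by blast
  show ?case
  proof (cases "u \<in> set xs")
    case True
    then obtain ys zs where "xs = ys @ u # zs" by (meson split_list)
    with xs path_edges_suffix[of "u # zs" ys] show ?thesis
      by (intro exI[of _ "u # zs"]) auto
  next
    case False
    obtain xs' where "xs = w # xs'" using xs by (cases xs) auto
    with xs False step(1) show ?thesis
      by (intro exI[of _ "u # xs"]) auto
  qed
qed

lemma graph_acyclic_mono: "graph_acyclic E \<Longrightarrow> F \<subseteq> E \<Longrightarrow> graph_acyclic F"
  unfolding graph_acyclic_def by blast

text \<open>Every edge of a forest is a bridge: a simple path joining its ends without it would
  close up with it to a circuit.\<close>

lemma graph_acyclic_bridge:
  assumes "graph_acyclic E" "{u, v} \<in> E" "u \<noteq> v"
  shows "(u, v) \<notin> (adj (E - {{u, v}}))\<^sup>*"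
proof
  assume "(u, v) \<in> (adj (E - {{u, v}}))\<^sup>*"
  then obtain xs where xs: "distinct xs" "xs \<noteq> []" "hd xs = u" "last xs = v"
      "path_edges xs \<subseteq> E - {{u, v}}"
    using rtrancl_adj_imp_path by metis
  obtain x y zs where eq: "xs = x # y # zs"
    using xs assms(3) by (metis last.simps list.exhaust list.sel(1))
  \<comment> \<open>Otherwise the path would consist of the deleted edge \<open>{u, v}\<close>
    itself.\<close>
  have "zs \<noteq> []" using xs eq by auto
  then have "3 \<le> length xs" using eq by (cases zs) auto
  moreover have "{last xs, hd xs} \<in> E" using xs assms by (simp add: insert_commute)
  ultimately show False using assms(1) xs unfolding graph_acyclic_def by blast
qed

lemma rtrancl_adj_sym: "(x, y) \<in> (adj E)\<^sup>* \<Longrightarrow> (y, x) \<in> (adj E)\<^sup>*"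
  by (rule symD[OF sym_rtrancl]) (auto simp: sym_def insert_commute)

lemma rtrancl_adj_mono: "E \<subseteq> F \<Longrightarrow> (x, y) \<in> (adj E)\<^sup>* \<Longrightarrow> (x, y) \<in> (adj F)\<^sup>*"
  by (rule subsetD[OF rtrancl_mono]) auto

section \<open>Products of edge transpositions\<close>

lemma edge_product_Nil [simp]: "edge_product [] = id"
  and edge_product_Cons [simp]: "edge_product (e # es) = edge_transposition e \<circ> edge_product es"
  by (simp_all add: edge_product_def)

lemma edge_product_append [simp]: "edge_product (es @ fs) = edge_product es \<circ> edge_product fs"
  by (induction es) (simp_all add: comp_assoc)

lemma edge_transposition_commute:
  assumes "card e = 2" "card f = 2" "e \<inter> f = {}"
  shows "edge_transposition e \<circ> edge_transposition f = edge_transposition f \<circ> edge_transposition e"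
proof -
  obtain a b c d where "e = {a, b}" "f = {c, d}" using assms by (auto simp: card_2_iff)
  with assms(3) show ?thesis
    by (auto simp: edge_transposition_pair fun_eq_iff transpose_def)
qed

lemma edge_transposition_commute_product:
  assumes "card e = 2" "\<forall>f\<in>set fs. card f = 2" "\<forall>f\<in>set fs. e \<inter> f = {}"
  shows "edge_transposition e \<circ> edge_product fs = edge_product fs \<circ> edge_transposition e"
  using assms(2,3)
proof (induction fs)
  case (Cons f fs)
  then show ?case
    using edge_transposition_commute[OF assms(1), of f]
    by (metis comp_assoc edge_product_Cons list.set_intros)
qed simp

lemma edge_product_fixes:
  assumes "\<forall>e\<in>set es. card e = 2" "x \<notin> \<Union>(set es)"
  shows "edge_product es x = x"
  using assms
proof (induction es)
  case (Cons e es)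
  obtain a b where "e = {a, b}" using Cons.prems by (auto simp: card_2_iff)
  with Cons show ?case by (auto simp: edge_transposition_pair)
qed simp

text \<open>Each factor either leaves a point in place or carries it along its own edge.\<close>

lemma edge_product_reachable:
  assumes "\<forall>e\<in>set es. card e = 2"
  shows "(x, edge_product es x) \<in> (adj (set es))\<^sup>*"
  using assms
proof (induction es)
  case (Cons e es)
  obtain a b where e: "e = {a, b}" using Cons.prems by (auto simp: card_2_iff)
  let ?y = "edge_product es x"
  have "(x, ?y) \<in> (adj (set (e # es)))\<^sup>*"
    using Cons by (intro rtrancl_adj_mono[of "set es" "set (e # es)" x ?y]) auto
  moreover have "(?y, edge_transposition e ?y) \<in> (adj (set (e # es)))\<^sup>*"
    unfolding e edge_transposition_pair transpose_def
    by (auto simp: insert_commute intro!: r_into_rtrancl)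
  ultimately show ?case by (simp add: e)
qed simp

text \<open>The orbit of \<open>v\<close> under successive distinct edges is a trail, which in a forest never
  returns to its start.\<close>

lemma edge_product_moves:
  assumes "graph_acyclic (set es)" "\<forall>e\<in>set es. card e = 2" "distinct es" "v \<in> \<Union>(set es)"
  shows "edge_product es v \<noteq> v"
proof
  assume fix_v: "edge_product es v = v"
  obtain e where e: "e \<in> set es" "v \<in> e" using assms(4) by auto
  \<comment> \<open>Factors act from the right, so the last edge \<open>f\<close> of the list that
    contains \<open>v\<close> is the first to move it.\<close>
  obtain as f bs where es: "es = as @ f # bs" and f: "v \<in> f" and bs: "\<forall>g\<in>set bs. v \<notin> g"
    using split_list_last_prop[of es "\<lambda>e. v \<in> e"] e by metis
  obtain w where w: "f = {v, w}" "v \<noteq> w"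
    using f assms(2) es by (auto simp: card_2_iff doubleton_eq_iff)
  have "edge_product bs v = v" using assms(2) bs es by (intro edge_product_fixes) auto
  then have "edge_product as w = v"
    using fix_v by (simp add: es w edge_transposition_pair)
  \<comment> \<open>The factors \<open>as\<close> bring \<open>w\<close> back to \<open>v\<close>,
    and by distinctness they do not include \<open>f\<close>, which is a bridge.\<close>
  then have "(w, v) \<in> (adj (set as))\<^sup>*"
    using edge_product_reachable[of as w] assms(2) es by auto
  moreover have "set as \<subseteq> set es - {{v, w}}" using assms(3) es w by auto
  ultimately have "(v, w) \<in> (adj (set es - {{v, w}}))\<^sup>*"
    using rtrancl_adj_sym rtrancl_adj_mono by metis
  moreover have "{v, w} \<in> set es" using es w by simp
  ultimately show False using graph_acyclic_bridge[OF assms(1) _ w(2)] by blast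
qed

section \<open>Orderings whose consecutive edges meet\<close>

lemma edge_chain_connected:
  assumes "edge_chain es" "es \<noteq> []" "\<forall>e\<in>set es. card e = 2" "x \<in> hd es" "y \<in> \<Union>(set es)"
  shows "(x, y) \<in> (adj (set es))\<^sup>*"
  using assms
proof (induction es arbitrary: x)
  case (Cons e es)
  have in_e: "(x, z) \<in> (adj (set (e # es)))\<^sup>*" if "z \<in> e" for z
  proof -
    have "card e = 2" using Cons.prems by simp
    then have "x = z \<or> {x, z} = e" using that Cons.prems by (auto simp: card_2_iff)
    then show ?thesis by auto
  qed
  show ?case
  proof (cases "y \<in> e")
    case False
    then obtain f fs where es: "es = f # fs" using Cons.prems by (cases es) auto
    \<comment> \<open>The walk changes from \<open>e\<close> to the rest of the chain at a vertex
      shared with the next edge.\<close>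
    then obtain z where z: "z \<in> e" "z \<in> f" using Cons.prems by auto
    have "(z, y) \<in> (adj (set es))\<^sup>*" using Cons False es z by auto
    then have "(z, y) \<in> (adj (set (e # es)))\<^sup>*" by (rule rtrancl_adj_mono[rotated]) auto
    with in_e[OF z(1)] show ?thesis by (rule rtrancl_trans)
  qed (use in_e in blast)
qed simp

text \<open>The remaining edges form a connected chain through \<open>v\<close>; if they also
  covered \<open>u\<close>, they would join \<open>u\<close> to \<open>v\<close> without the bridge
  \<open>e\<close>.\<close>

lemma edge_chain_first_leaf:
  assumes "graph_acyclic (set (e # f # es))" "\<forall>g\<in>set (e # f # es). card g = 2"
    "distinct (e # f # es)" "edge_chain (e # f # es)"
  obtains u v where "e = {u, v}" "u \<noteq> v" "v \<in> f" "u \<notin> \<Union>(set (f # es))"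
proof -
  obtain v where v: "v \<in> e" "v \<in> f" using assms(4) by auto
  obtain u where u: "e = {u, v}" "u \<noteq> v"
    using assms(2) v(1) by (auto simp: card_2_iff doubleton_eq_iff insert_commute)
  have "u \<notin> \<Union>(set (f # es))"
  proof
    assume "u \<in> \<Union>(set (f # es))"
    then have "(v, u) \<in> (adj (set (f # es)))\<^sup>*"
      using assms v by (intro edge_chain_connected) auto
    moreover have "set (f # es) \<subseteq> set (e # f # es) - {{u, v}}" using assms(3) u by auto
    ultimately have "(u, v) \<in> (adj (set (e # f # es) - {{u, v}}))\<^sup>*"
      using rtrancl_adj_sym rtrancl_adj_mono by metis
    then show False using graph_acyclic_bridge[OF assms(1) _ u(2)] u(1) by auto
  qed
  with that u v show thesis by blast
qed

lemma edge_chain_unique: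
  assumes "graph_acyclic (set es)" "\<forall>e\<in>set es. card e = 2" "distinct es" "edge_chain es"
    "distinct fs" "set fs = set es" "edge_product fs = edge_product es"
  shows "fs = es"
  using assms
proof (induction es arbitrary: fs)
  case (Cons e es)
  show ?case
  proof (cases es)
    case Nil
    with Cons.prems have "length fs = 1" by (metis distinct_card length_Cons list.size(3) One_nat_def)
    with Cons.prems Nil show ?thesis by (cases fs) auto
  next
    case es: (Cons e' es')
    obtain u v where e: "e = {u, v}" "u \<noteq> v" and v: "v \<in> e'" and u: "u \<notin> \<Union>(set es)"
      using edge_chain_first_leaf[of e e' es'] Cons.prems unfolding es by metis
    obtain as bs where fs: "fs = as @ e # bs"
      using Cons.prems(6) by (metis list.set_intros(1) split_list)
    have rest: "set (as @ bs) = set es" using Cons.prems(3,5,6) fs by auto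
    then have c2: "\<forall>g\<in>set as. card g = 2" "\<forall>g\<in>set bs. card g = 2"
      using Cons.prems(2) by auto
    have "edge_product bs u = u" using u rest c2 by (intro edge_product_fixes) auto
    moreover have "edge_product es u = u" using u Cons.prems(2) by (intro edge_product_fixes) auto
    \<comment> \<open>Both products are evaluated at \<open>u\<close>: one gives \<open>v\<close>,
      while in the other \<open>bs\<close> fixes \<open>u\<close>, \<open>e\<close> sends it to
      \<open>v\<close>, and \<open>as\<close> acts on \<open>v\<close>.\<close>
    ultimately have "edge_product as v = v"
      using fun_cong[OF Cons.prems(7), of u] fs e by (simp add: edge_transposition_pair)
    moreover have "graph_acyclic (set as)"
      using Cons.prems(1) rest by (auto intro: graph_acyclic_mono)
    ultimately have v_as: "v \<notin> \<Union>(set as)"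
      using edge_product_moves[of as v] c2 Cons.prems(5) fs by auto
    \<comment> \<open>Neither end of \<open>e\<close> is covered by \<open>as\<close>, so
      \<open>e\<close> can be moved to the front and cancelled.\<close>
    then have "edge_transposition e \<circ> edge_product as = edge_product as \<circ> edge_transposition e"
      using e u rest c2 by (intro edge_transposition_commute_product) auto
    then have "edge_transposition e \<circ> edge_product (as @ bs) = edge_transposition e \<circ> edge_product es"
      using Cons.prems(7) fs by (metis comp_assoc edge_product_Cons edge_product_append)
    then have "edge_product (as @ bs) = edge_product es"
      by (simp add: e edge_transposition_pair fun_eq_iff)
        (metis transpose_involutory)
    then have "as @ bs = es"
      using Cons.prems rest fs es by (intro Cons.IH) (auto intro: graph_acyclic_mono)
    \<comment> \<open>A nonempty \<open>as\<close> would begin with \<open>e'\<close>, the head of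
      \<open>es\<close>, which contains \<open>v\<close>.\<close>
    with v_as v es have "as = []" by (cases as) auto
    with fs \<open>as @ bs = es\<close> show ?thesis by simp
  qed
qed simp

text \<open>Rotating the list does not change the cycle. This allows a new leaf to be placed right
  before its neighbour.\<close>

lemma cycle_of_list_starting_at:
  assumes "distinct cs" "v \<in> set cs"
  obtains ds where "distinct (v # ds)" "set (v # ds) = set cs"
    "cycle_of_list (v # ds) = cycle_of_list cs"
proof -
  obtain as bs where cs: "cs = as @ v # bs" using assms(2) by (meson split_list)
  have "rotate (length as) cs = v # bs @ as" by (simp add: cs rotate_append)
  then have "cycle_of_list (v # bs @ as) = cycle_of_list cs"
    using cycle_of_list_rotate_independent[OF assms(1)] by metis
  then show thesis using assms(1) cs by (intro that[of "bs @ as"]) auto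
qed

text \<open>By induction the remaining edges give a cycle, which can be written with
  \<open>v\<close> first; composing it with the transposition of the leaf \<open>u\<close> and
  \<open>v\<close> inserts \<open>u\<close> in front of \<open>v\<close>.\<close>

lemma edge_chain_product_cycle:
  assumes "graph_acyclic (set es)" "\<forall>e\<in>set es. card e = 2" "distinct es" "edge_chain es"
  shows "\<exists>cs. distinct cs \<and> set cs = \<Union>(set es) \<and> edge_product es = cycle_of_list cs"
  using assms
proof (induction es)
  case Nil
  \<comment> \<open>The identity is the cycle of the empty list.\<close>
  show ?case by (rule exI[of _ "[]"]) simp
next
  case (Cons e es)
  show ?case
  proof (cases es)
    case Nil
    obtain u v where "e = {u, v}" "u \<noteq> v" using Cons.prems by (auto simp: card_2_iff)
    with Nil show ?thesis
      by (intro exI[of _ "[u, v]"]) (simp add: edge_transposition_pair)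
  next
    case es: (Cons e' es')
    obtain u v where e: "e = {u, v}" "u \<noteq> v" and v: "v \<in> e'" and u: "u \<notin> \<Union>(set es)"
      using edge_chain_first_leaf[of e e' es'] Cons.prems unfolding es by metis
    have "graph_acyclic (set es)" using Cons.prems(1) by (rule graph_acyclic_mono) auto
    moreover have "edge_chain es" using Cons.prems(4) es by simp
    ultimately obtain cs where
        cs: "distinct cs" "set cs = \<Union>(set es)" "edge_product es = cycle_of_list cs"
      using Cons.IH Cons.prems(2,3) by auto
    then obtain ds where ds: "distinct (v # ds)" "set (v # ds) = set cs"
        "cycle_of_list (v # ds) = cycle_of_list cs"
      using cycle_of_list_starting_at[of cs v] v es by auto
    have "edge_product (e # es) = cycle_of_list (u # v # ds)"
      using ds cs e by (simp add: edge_transposition_pair)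
    moreover have "distinct (u # v # ds)" using ds u cs by auto
    moreover have "set (u # v # ds) = \<Union>(set (e # es))" using ds cs e by auto
    ultimately show ?thesis by blast
  qed
qed

section \<open>Orderings determined by their product\<close>

lemma unique_ordering_imp_edge_chain:
  assumes "distinct es" "\<forall>e\<in>set es. card e = 2"
    and unique: "\<And>fs. distinct fs \<Longrightarrow> set fs = set es \<Longrightarrow> edge_product fs = edge_product es \<Longrightarrow> fs = es"
  shows "edge_chain es"
proof -
  have "es ! i \<inter> es ! Suc i \<noteq> {}" if i: "Suc i < length es" for i
  proof
    assume disj: "es ! i \<inter> es ! Suc i = {}"
    define as bs where "as = take i es" and "bs = drop (Suc (Suc i)) es"
    let ?e = "es ! i" and ?f = "es ! Suc i"
    have es: "es = as @ ?e # ?f # bs"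
      using i unfolding as_def bs_def by (metis Cons_nth_drop_Suc Suc_lessD append_take_drop_id)
    let ?fs = "as @ ?f # ?e # bs"
    have "edge_transposition ?e \<circ> edge_transposition ?f = edge_transposition ?f \<circ> edge_transposition ?e"
      using i assms(2) disj by (intro edge_transposition_commute) auto
    then have "edge_product ?fs = edge_product (as @ ?e # ?f # bs)"
      by (metis comp_assoc edge_product_Cons edge_product_append)
    then have "edge_product ?fs = edge_product es" using es by metis
    moreover have "distinct ?fs" using assms(1) by (subst (asm) es) auto
    moreover have "set ?fs = set es" using arg_cong[OF es, of set] by auto
    \<comment> \<open>Uniqueness forces the swapped ordering to be the original one, so the two
      edges coincide, against distinctness.\<close>
    ultimately have "?fs = as @ ?e # ?f # bs" using unique es by metis
    then have "?e = ?f" by (metis list.inject same_append_eq)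
    then show False using assms(1) i by (simp add: nth_eq_iff_index_eq)
  qed
  then show ?thesis by (simp add: successively_conv_nth)
qed

section \<open>Spines and chains of edges\<close>

lemma inner_verticesI:
  "e \<in> E \<Longrightarrow> f \<in> E \<Longrightarrow> e \<noteq> f \<Longrightarrow> x \<in> e \<Longrightarrow> x \<in> f \<Longrightarrow> x \<in> inner_vertices E"
  unfolding inner_vertices_def by auto

text \<open>The new leaf \<open>u\<close> lies on one edge only, \<open>v\<close> was covered before
  and gains a second edge, and no other degree changes.\<close>

lemma inner_vertices_insert_leaf:
  assumes "u \<notin> \<Union>F" "v \<in> \<Union>F"
  shows "inner_vertices (insert {u, v} F) = insert v (inner_vertices F)"
proof (intro equalityI subsetI)
  fix x assume "x \<in> inner_vertices (insert {u, v} F)"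
  then obtain e f where ef: "e \<in> insert {u, v} F" "f \<in> insert {u, v} F" "e \<noteq> f" "x \<in> e" "x \<in> f"
    unfolding inner_vertices_def by blast
  show "x \<in> insert v (inner_vertices F)"
  proof (cases "e \<in> F \<and> f \<in> F")
    case True
    with ef(3-5) have "x \<in> inner_vertices F" unfolding inner_vertices_def by blast
    then show ?thesis by simp
  next
    case False
    then have "x \<in> \<Union>F" "x \<in> {u, v}" using ef by blast+
    then show ?thesis using assms(1) by auto
  qed
next
  fix x assume "x \<in> insert v (inner_vertices F)"
  then show "x \<in> inner_vertices (insert {u, v} F)"
  proof
    assume x: "x = v"
    obtain g where g: "g \<in> F" "v \<in> g" using assms(2) by blast
    then have "{u, v} \<noteq> g" using assms(1) by blast
    with g show ?thesis unfolding x by (intro inner_verticesI[of "{u, v}" _ g]) auto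
  next
    assume "x \<in> inner_vertices F"
    then show ?thesis unfolding inner_vertices_def by blast
  qed
qed

text \<open>Prepending a leaf edge at \<open>v\<close> either keeps the spine or extends it by
  \<open>v\<close> at the front. The clause on \<open>hd xs\<close> is carried along to show that
  \<open>v\<close> is, or is joined to, the head of the spine.\<close>

lemma edge_chain_imp_spine:
  assumes "graph_acyclic (set es)" "\<forall>e\<in>set es. card e = 2" "distinct es" "edge_chain es" "es \<noteq> []"
  shows "\<exists>xs. distinct xs \<and> set xs = inner_vertices (set es)
    \<and> path_edges xs = {e \<in> set es. e \<subseteq> inner_vertices (set es)} \<and> (xs \<noteq> [] \<longrightarrow> hd xs \<in> hd es)"
  using assms
proof (induction es)
  case (Cons e es)
  show ?case
  proof (cases es)
    case Nil
    have "e \<noteq> {}" using Cons.prems by auto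
    with Nil show ?thesis by (intro exI[of _ "[]"]) (auto simp: inner_vertices_def)
  next
    case es: (Cons f fs)
    obtain u v where e: "e = {u, v}" "u \<noteq> v" and v: "v \<in> f" and u: "u \<notin> \<Union>(set es)"
      using edge_chain_first_leaf[of e f fs] Cons.prems unfolding es by metis
    have acyclic_es: "graph_acyclic (set es)" using Cons.prems(1) by (rule graph_acyclic_mono) auto
    let ?N = "inner_vertices (set es)"
    have N: "inner_vertices (set (e # es)) = insert v ?N"
      using inner_vertices_insert_leaf[of u "set es" v] u v es e by auto
    \<comment> \<open>The end \<open>u\<close> of \<open>e\<close> is a leaf, so \<open>e\<close> is
      not a spine edge.\<close>
    have "u \<notin> insert v ?N" using u e by (auto simp: inner_vertices_def)
    then have I: "{g \<in> set (e # es). g \<subseteq> insert v ?N} = {g \<in> set es. g \<subseteq> insert v ?N}"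
      using e by auto
    obtain xs where xs: "distinct xs" "set xs = ?N" "path_edges xs = {g \<in> set es. g \<subseteq> ?N}"
        "xs \<noteq> [] \<longrightarrow> hd xs \<in> f"
      using Cons.IH Cons.prems acyclic_es es by auto
    obtain w where f: "f = {v, w}" "v \<noteq> w"
      using Cons.prems(2) v es by (auto simp: card_2_iff doubleton_eq_iff)
    \<comment> \<open>The first edge \<open>f\<close> of the shorter chain has a leaf end there, so
      the spine can touch it in only one vertex.\<close>
    have not_both: "v \<notin> ?N \<or> w \<notin> ?N"
    proof (cases fs)
      case Nil
      then show ?thesis using es by (auto simp: inner_vertices_def)
    next
      case (Cons f' fs')
      obtain a b where "f = {a, b}" "a \<notin> \<Union>(set fs)"
        using edge_chain_first_leaf[of f f' fs'] acyclic_es Cons.prems(2-4) es Cons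
        by (metis distinct.simps(2) list.set_intros(2) successively.simps(3))
      then have "a \<notin> ?N" "a \<in> f" using es by (auto simp: inner_vertices_def)
      with f show ?thesis by auto
    qed
    show ?thesis
    proof (cases "v \<in> ?N")
      case True
      then have "xs \<noteq> []" "hd xs \<in> ?N"
        using xs(2) by (metis empty_iff list.set(1), metis empty_iff hd_in_set list.set(1))
      with xs(4) not_both True f have "hd xs = v" by auto
      with xs True N I e show ?thesis
        by (intro exI[of _ xs]) (auto simp: insert_absorb)
    next
      case False
      \<comment> \<open>Not being inner in \<open>es\<close>, \<open>v\<close> lies on
        \<open>f\<close> alone, so \<open>f\<close> is the only possible new spine edge.\<close>
      have only: "g = f" if "g \<in> set es" "v \<in> g" for g
        using that False es v by (auto simp: inner_vertices_def)
      have "path_edges (v # xs) = {g \<in> set es. g \<subseteq> insert v ?N}"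
      proof (cases xs)
        case Nil
        then have "?N = {}" using xs(2) by simp
        have "\<not> g \<subseteq> insert v ?N" if "g \<in> set es" for g
        proof
          assume "g \<subseteq> insert v ?N"
          then have "g \<subseteq> {v}" using \<open>?N = {}\<close> by simp
          moreover have "card g = 2" using Cons.prems(2) that by simp
          ultimately show False using card_mono[of "{v}" g] by simp
        qed
        then show ?thesis using Nil by auto
      next
        case (Cons x xs')
        then have "x \<in> ?N" "x \<in> f" using xs(2,4) by auto
        with False f have x: "x = w" by auto
        have "{g \<in> set es. g \<subseteq> insert v ?N} = insert f {g \<in> set es. g \<subseteq> ?N}"
          using only f es \<open>x \<in> ?N\<close> x by auto
        then show ?thesis using Cons xs(3) f x by simp
      qed
      then show ?thesis using xs False N I e by (intro exI[of _ "v # xs"]) auto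
    qed
  qed
qed simp

lemma edge_chain_of_star: "\<forall>e\<in>set es. x \<in> e \<Longrightarrow> edge_chain es"
  by (induction es rule: induct_list012) auto

text \<open>Walk along the spine: list the edges at \<open>x\<close> with \<open>{x, y}\<close>
  last, then continue from \<open>y\<close> with the edges avoiding \<open>x\<close>. The clause on
  heads makes the pieces fit; it is guarded because no edges may be left at the last spine
  vertex.\<close>

lemma spine_imp_edge_chain:
  assumes "xs \<noteq> []" "distinct xs" "finite F" "path_edges xs \<subseteq> F" "\<forall>e\<in>F. e \<inter> set xs \<noteq> {}"
  shows "\<exists>es. distinct es \<and> set es = F \<and> edge_chain es \<and> (es \<noteq> [] \<longrightarrow> hd xs \<in> hd es)"
  using assms
proof (induction xs arbitrary: F rule: induct_list012)
  case (2 x)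
  obtain es where es: "distinct es" "set es = F" using 2 finite_distinct_list by metis
  then have "\<forall>e\<in>set es. x \<in> e" using 2 by auto
  with es show ?case by (intro exI[of _ es]) (auto intro: edge_chain_of_star)
next
  case (3 x y xs)
  define P where "P = {e \<in> F. x \<in> e} - {{x, y}}"
  let ?F = "{e \<in> F. x \<notin> e}"
  obtain ps where ps: "distinct ps" "set ps = P"
    using "3.prems"(3) finite_distinct_list[of P] by (auto simp: P_def)
  \<comment> \<open>By distinctness the later spine edges avoid \<open>x\<close>, so they survive
    the removal of the star at \<open>x\<close>.\<close>
  have "path_edges (y # xs) \<subseteq> ?F"
    using "3.prems"(2,4) path_edges_in_set[of _ "y # xs"] by auto
  moreover have "\<forall>e\<in>?F. e \<inter> set (y # xs) \<noteq> {}" using "3.prems"(5) by auto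
  ultimately obtain es where es: "distinct es" "set es = ?F" "edge_chain es" "es \<noteq> [] \<longrightarrow> y \<in> hd es"
    using "3.IH"(2)[of ?F] "3.prems"(2,3) by auto
  have star: "\<forall>e\<in>set (ps @ [{x, y}]). x \<in> e" using ps by (auto simp: P_def)
  let ?es = "(ps @ [{x, y}]) @ es"
  have "distinct ?es" using ps es by (auto simp: P_def)
  moreover have "set ?es = F" using ps es "3.prems"(4) by (auto simp: P_def)
  moreover have "edge_chain ?es"
    using es edge_chain_of_star[OF star] unfolding successively_append_iff[of _ "ps @ [{x, y}]"]
    by auto
  moreover have "x \<in> hd ?es" using star by (cases ps) auto
  ultimately show ?case by (metis list.sel(1))
qed simp

section \<open>Inner vertices of trees and the caterpillar condition\<close>

text \<open>Connectedness excludes degree 0 once there is an edge, so a vertex that is not a leaf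
  has degree at least 2.\<close>

lemma non_leaves_eq_inner_vertices:
  assumes "is_tree V E" "E \<noteq> {}"
  shows "V - leaves V E = inner_vertices E"
proof -
  have E: "\<forall>e\<in>E. e \<subseteq> V \<and> card e = 2"
    using assms(1) by (auto simp: is_tree_def simple_graph_def)
  have "vertex_degree E x \<noteq> 1 \<longleftrightarrow> x \<in> inner_vertices E" if x: "x \<in> V" for x
  proof -
    let ?D = "{e \<in> E. x \<in> e}"
    have "?D \<noteq> {}"
    proof -
      obtain e where "e \<in> E" using assms(2) by blast
      moreover from this obtain a b where "e = {a, b}" "a \<noteq> b"
        using E card_2_iff by metis
      ultimately have e: "e \<in> E" "a \<in> e" "b \<in> e" "a \<noteq> b" by auto
      \<comment> \<open>An edge has two ends, so one of them differs from \<open>x\<close>; the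
        first step of a walk from \<open>x\<close> to it is an edge at \<open>x\<close>.\<close>
      then obtain y where y: "y \<in> V" "y \<noteq> x" using E by blast
      then have "(x, y) \<in> (adj E)\<^sup>*"
        using assms(1) x by (auto simp: is_tree_def graph_connected_def)
      then show ?thesis using y(2) by (cases rule: converse_rtranclE) auto
    qed
    then have "is_singleton ?D \<longleftrightarrow> (\<forall>e\<in>?D. \<forall>f\<in>?D. e = f)"
      by (metis (no_types, lifting) is_singletonE is_singletonI' singletonD)
    then show ?thesis
      unfolding vertex_degree_def inner_vertices_def is_singleton_altdef[symmetric] by blast
  qed
  moreover have "inner_vertices E \<subseteq> V" using E by (auto simp: inner_vertices_def)
  ultimately show ?thesis by (auto simp: leaves_def)
qed

lemma inner_edges_eq:
  assumes "is_tree V E" "E \<noteq> {}"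
  shows "{e \<in> E. e \<inter> leaves V E = {}} = {e \<in> E. e \<subseteq> inner_vertices E}"
  using assms(1) unfolding non_leaves_eq_inner_vertices[OF assms, symmetric]
  by (auto simp: is_tree_def simple_graph_def)

text \<open>If neither end of \<open>e\<close> were inner, no walk could leave \<open>e\<close>, so
  by connectedness \<open>f\<close> would lie inside \<open>e\<close>.\<close>

lemma tree_edge_meets_inner_vertices:
  assumes "is_tree V E" "e \<in> E" "f \<in> E" "e \<noteq> f"
  shows "e \<inter> inner_vertices E \<noteq> {}"
proof
  assume disj: "e \<inter> inner_vertices E = {}"
  have E: "\<forall>e\<in>E. e \<subseteq> V \<and> card e = 2"
    using assms(1) by (auto simp: is_tree_def simple_graph_def)
  then obtain a where a: "a \<in> e" using assms(2) by fastforce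
  have "y \<in> e" if "(a, y) \<in> (adj E)\<^sup>*" for y
    using that
  proof induction
    case (step y z)
    then have "{y, z} = e" using disj assms(2) inner_verticesI[of "{y, z}" E e y] by auto
    then show ?case by auto
  qed (rule a)
  then have "f \<subseteq> e"
    using assms(1-3) E a unfolding is_tree_def graph_connected_def by blast
  moreover have "finite e" "card f = card e"
    using E assms(2,3) by (auto intro: card_ge_0_finite)
  ultimately show False using assms(4) card_subset_eq[of e f] by simp
qed

lemma caterpillar_iff_edge_chain:
  assumes "is_tree V E"
  shows "is_caterpillar V E \<longleftrightarrow> (\<exists>es\<in>permutations_of_set E. edge_chain es)"
proof (cases "E = {}")
  case True
  have "V = {v}" if v: "v \<in> V" for v
  proof -
    have "y = v" if "y \<in> V" for y
      using assms v that True by (auto simp: is_tree_def graph_connected_def)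
    with v show ?thesis by blast
  qed
  moreover have "V \<noteq> {}" using assms by (simp add: is_tree_def graph_connected_def)
  ultimately obtain v where v: "V = {v}" by blast
  \<comment> \<open>The only vertex has degree 0, so it is not a leaf and remains as a one-vertex
    path; the empty ordering is trivially a chain.\<close>
  have "is_path_graph (V - leaves V E) {e \<in> E. e \<inter> leaves V E = {}}"
    unfolding is_path_graph_def
    by (rule exI[of _ "[v]"]) (simp add: True v leaves_def vertex_degree_def)
  then show ?thesis using assms True by (auto simp: is_caterpillar_def)
next
  case False
  have E: "\<forall>e\<in>E. card e = 2" "finite E" "graph_acyclic E"
    using assms finite_subset[of E "Pow V"]
    by (auto simp: is_tree_def simple_graph_def)
  have cat: "is_caterpillar V E \<longleftrightarrow>
      (\<exists>xs. distinct xs \<and> set xs = inner_vertices E \<and> path_edges xs = {e \<in> E. e \<subseteq> inner_vertices E})"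
    using assms unfolding is_caterpillar_def is_path_graph_def
      non_leaves_eq_inner_vertices[OF assms False] inner_edges_eq[OF assms False] by simp
  show ?thesis
  proof
    assume "is_caterpillar V E"
    then obtain xs where xs: "distinct xs" "set xs = inner_vertices E"
        "path_edges xs = {e \<in> E. e \<subseteq> inner_vertices E}"
      using cat by blast
    show "\<exists>es\<in>permutations_of_set E. edge_chain es"
    \<comment> \<open>A single edge has no inner vertex, so its spine is empty and cannot guide the
      walk; its only ordering is given directly.\<close>
    proof (cases "\<exists>e. E = {e}")
      case True
      then obtain e where "E = {e}" by blast
      then show ?thesis by (intro bexI[of _ "[e]"]) (auto simp: permutations_of_set_def)
    next
      case not_single: False
      have meets: "e \<inter> set xs \<noteq> {}" if e: "e \<in> E" for e
      proof -
        have "\<exists>f\<in>E. e \<noteq> f"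
        proof (rule ccontr)
          assume "\<not> (\<exists>f\<in>E. e \<noteq> f)"
          with e have "E = {e}" by blast
          with not_single show False by blast
        qed
        then show ?thesis using tree_edge_meets_inner_vertices[OF assms e] xs(2) by metis
      qed
      then have "xs \<noteq> []" using False by auto
      then have "\<exists>es. distinct es \<and> set es = E \<and> edge_chain es \<and> (es \<noteq> [] \<longrightarrow> hd xs \<in> hd es)"
        using xs E meets by (intro spine_imp_edge_chain) auto
      then show ?thesis by (auto simp: permutations_of_set_def)
    qed
  next
    assume "\<exists>es\<in>permutations_of_set E. edge_chain es"
    then obtain es where es: "distinct es" "set es = E" "edge_chain es"
      by (auto simp: permutations_of_set_def)
    then have "es \<noteq> []" using False by auto
    then show "is_caterpillar V E"
      using edge_chain_imp_spine[of es] E es unfolding cat es(2) by blast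
  qed
qed

section \<open>Multiplicity one and chains of edges\<close>

theorem theorem3p2:
  fixes V :: "'a set" and E :: "'a set set"
  assumes "is_tree V E"
  shows "(\<exists>c. is_cycle c \<and> (\<exists>es \<in> permutations_of_set E. edge_product es = c)
            \<and> cycle_multiplicity E c = 1)
         \<longleftrightarrow> is_caterpillar V E"
proof -
  have E: "\<forall>e\<in>E. card e = 2" "graph_acyclic E"
    using assms by (auto simp: is_tree_def simple_graph_def)
  show ?thesis
    unfolding caterpillar_iff_edge_chain[OF assms]
  proof
    assume "\<exists>c. is_cycle c \<and> (\<exists>es \<in> permutations_of_set E. edge_product es = c)
      \<and> cycle_multiplicity E c = 1"
    then obtain es where es: "es \<in> permutations_of_set E"
        and "cycle_multiplicity E (edge_product es) = 1" by blast
    then obtain es' where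
        es': "{fs \<in> permutations_of_set E. edge_product fs = edge_product es} = {es'}"
      unfolding cycle_multiplicity_def by (meson card_1_singletonE)
    have "fs = es" if "distinct fs" "set fs = set es" "edge_product fs = edge_product es" for fs
    proof -
      have "fs \<in> {es'}" "es \<in> {es'}"
        using that es unfolding es'[symmetric] by (auto simp: permutations_of_set_def)
      then show ?thesis by simp
    qed
    then have "edge_chain es"
      using es E by (intro unique_ordering_imp_edge_chain) (auto simp: permutations_of_set_def)
    with es show "\<exists>es\<in>permutations_of_set E. edge_chain es" by blast
  next
    assume "\<exists>es\<in>permutations_of_set E. edge_chain es"
    then obtain es where es: "distinct es" "set es = E" "edge_chain es"
      by (auto simp: permutations_of_set_def)
    \<comment> \<open>A chain is recovered from its product, so it is the only ordering
      counted.\<close>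
    have "{fs \<in> permutations_of_set E. edge_product fs = edge_product es} = {es}"
      using edge_chain_unique[of es] es E by (auto simp: permutations_of_set_def)
    then have "cycle_multiplicity E (edge_product es) = 1"
      by (simp add: cycle_multiplicity_def)
    moreover have "is_cycle (edge_product es)"
      using edge_chain_product_cycle[of es] es E by (auto simp: is_cycle_def)
    moreover have "es \<in> permutations_of_set E" using es by (auto simp: permutations_of_set_def)
    ultimately show "\<exists>c. is_cycle c \<and> (\<exists>es \<in> permutations_of_set E. edge_product es = c)
      \<and> cycle_multiplicity E c = 1" by blast
  qed
qed

end
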